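(* Let $X_t=\sigma W(\tau_t)$ and $\tilde X_t=X_t+\varepsilon_t$, where $\{\varepsilon_t\}_{t\ge 0}$ is a centered stationary noise process with finite moments of all orders, independent of $X$. For $K\ge2$ let $$\hat{\bar\kappa}_n:=\frac{1}{3\sigma^4(K-1)}\sum_{i=1}^K\frac1{T_{i,K}}[\tilde X,\tilde X]_4^{\mathcal G_n^{(i)}}-\frac{1}{3\sigma^4(K-1)T}[\tilde X,\tilde X]_4^{\bar{\mathcal G}_n}-\frac{2}{n\sigma^2}[\tilde X,\tilde X]_2^{\bar{\mathcal G}_n}-(K-1)\delta_n .$$ If the noise is white, i.e. the variables $\{\varepsilon_t\}_{t\ge0}$ are i.i.d., then $\hat{\bar\kappa}_n$ is an unbiased estimator of $\kappa$. Furthermore, for a general centered stationary noise process, $$\mathbb{E}\left(\hat{\bar\kappa}_n\right)=\kappa+\frac{2}{\sigma^2}\frac{K}{K-1}\left(\mathbb{E}(\tilde\varepsilon_{K\delta_n}^2)-\mathbb{E}(\tilde\varepsilon_{\delta_n}^2)\right)+\frac{1}{3\sigma^4}\,\frac{\mathbb{E}(\tilde\varepsilon_{K\delta_n}^4)-\mathbb{E}(\tilde\varepsilon_{\delta_n}^4)}{\delta_n(K-1)},$$ so that $\hat{\bar\kappa}_n$ is asymptotically unbiased if, for every $\ell\in\mathbb{N}$, $$\lim_{\delta_1,\delta_2\to0}\frac{\mathbb{E}[\tilde\varepsilon_{\delta_2}^{\ell}]-\mathbb{E}[\tilde\varepsilon_{\delta_1}^{\ell}]}{\delta_2-\delta_1}=0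 .$$
   Context: $\sigma,\kappa>0$ ($\sigma$ is treated as known in the estimator); $W$ is a standard Brownian motion; $\tau=\{\tau_t\}_{t\ge0}$ is a subordinator (non-decreasing Lévy process) independent of $W$ with $\mathbb{E}\tau_t=t$, $\mathrm{Var}(\tau_t)=\kappa t$, and $\mathbb{E}\tau_1^j<\infty$ for $j=1,\dots,8$. For a horizon $T>0$ and $n\in\mathbb{N}$: $\delta_n:=T/n$, $t_i:=i\delta_n$, $\bar{\mathcal G}_n:=\{t_0,\dots,t_n\}$. For $1\le i\le K$: $n_i:=\lfloor (n-i+1)/K\rfloor$, $\mathcal G_n^{(i)}:=\{t_{i-1},t_{i-1+K},t_{i-1+2K},\dots,t_{i-1+n_iK}\}$, $T_{i,K}:=K\delta_nn_i$; it is understood that $n_i\ge1$ for all $i$ (i.e. $n\ge 2K-1$). For a grid $\mathcal G=\{s_0<s_1<\dots<s_m\}$ and $\ell\in\mathbb{N}$, $[\tilde X,\tilde X]_\ell^{\mathcal G}:=\sum_{j=0}^{m-1}|\tilde X_{s_{j+1}}-\tilde X_{s_j}|^\ell$. For $\delta>0$, $\tilde\varepsilon_\delta$ denotes a random variable distributed as $\varepsilon_{t+\delta}-\varepsilon_t$ (the law does not depend on $t$). "Asymptotically unbiased" means the bias tends to $0$ as $\delta_n\to0$ and $K\delta_n\to0$ (in particular as $n\to\infty$ with $K$ and $T$ fixed). *)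

theory Defs
  imports "HOL-Probability.Probability"
begin

section \<open>Stochastic processes indexed by \<open>[0, \<infinity>)\<close>\<close>

text \<open>A process is a function \<open>real \<Rightarrow> 'a \<Rightarrow> real\<close> of which only the times \<open>t \<ge> 0\<close> matter.\<close>

definition process_on :: "'a measure \<Rightarrow> (real \<Rightarrow> 'a \<Rightarrow> real) \<Rightarrow> bool" where
  "process_on M Y \<longleftrightarrow> (\<forall>t\<ge>0. Y t \<in> borel_measurable M)"

text \<open>Independence of two processes: their paths are independent random elements of the product
  \<open>\<sigma>\<close>-algebra on \<open>real ^ [0, \<infinity>)\<close>.  As everywhere in the library, this includes that
  both are measurable.\<close>

definition indep_processes ::
    "'a measure \<Rightarrow> (real \<Rightarrow> 'a \<Rightarrow> real) \<Rightarrow> (real \<Rightarrow> 'a \<Rightarrow> real) \<Rightarrow> bool" where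
  "indep_processes M Y Z \<longleftrightarrow>
     prob_space.indep_var M
       (PiM {0..} (\<lambda>_. borel)) (\<lambda>\<omega>. \<lambda>t\<in>{0..}. Y t \<omega>)
       (PiM {0..} (\<lambda>_. borel)) (\<lambda>\<omega>. \<lambda>t\<in>{0..}. Z t \<omega>)"

definition indep_increments :: "'a measure \<Rightarrow> (real \<Rightarrow> 'a \<Rightarrow> real) \<Rightarrow> bool" where
  "indep_increments M Y \<longleftrightarrow>
     (\<forall>(m::nat) (s::nat \<Rightarrow> real). 0 \<le> s 0 \<and> (\<forall>i<m. s i < s (Suc i)) \<longrightarrow>
        prob_space.indep_vars M (\<lambda>_. borel) (\<lambda>i \<omega>. Y (s (Suc i)) \<omega> - Y (s i) \<omega>) {..<m})"

definition stationary_increments :: "'a measure \<Rightarrow> (real \<Rightarrow> 'a \<Rightarrow> real) \<Rightarrow> bool" where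
  "stationary_increments M Y \<longleftrightarrow>
     (\<forall>s\<ge>0. \<forall>h\<ge>0. distr M borel (\<lambda>\<omega>. Y (s + h) \<omega> - Y s \<omega>)
                    = distr M borel (\<lambda>\<omega>. Y h \<omega> - Y 0 \<omega>))"

definition cadlag :: "(real \<Rightarrow> real) \<Rightarrow> bool" where
  "cadlag y \<longleftrightarrow>
     (\<forall>t\<ge>0. (y \<longlongrightarrow> y t) (at_right t)) \<and> (\<forall>t>0. \<exists>l. (y \<longlongrightarrow> l) (at_left t))"

definition standard_brownian_motion :: "'a measure \<Rightarrow> (real \<Rightarrow> 'a \<Rightarrow> real) \<Rightarrow> bool" where
  "standard_brownian_motion M W \<longleftrightarrow>
     process_on M W \<and>
     (AE \<omega> in M. W 0 \<omega> = 0) \<and>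
     indep_increments M W \<and>
     (\<forall>s t. 0 \<le> s \<and> s < t \<longrightarrow>
        distributed M lborel (\<lambda>\<omega>. W t \<omega> - W s \<omega>) (normal_density 0 (sqrt (t - s)))) \<and>
     (AE \<omega> in M. continuous_on {0..} (\<lambda>t. W t \<omega>))"

definition levy_process :: "'a measure \<Rightarrow> (real \<Rightarrow> 'a \<Rightarrow> real) \<Rightarrow> bool" where
  "levy_process M L \<longleftrightarrow>
     process_on M L \<and>
     (AE \<omega> in M. L 0 \<omega> = 0) \<and>
     indep_increments M L \<and>
     stationary_increments M L \<and>
     (\<forall>t\<ge>0. \<forall>e>0. ((\<lambda>s. measure M {\<omega> \<in> space M. \<bar>L s \<omega> - L t \<omega>\<bar> > e}) \<longlongrightarrow> 0)
                    (at t within {0..})) \<and>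
     (AE \<omega> in M. cadlag (\<lambda>t. L t \<omega>))"

definition subordinator :: "'a measure \<Rightarrow> (real \<Rightarrow> 'a \<Rightarrow> real) \<Rightarrow> bool" where
  "subordinator M L \<longleftrightarrow>
     levy_process M L \<and> (AE \<omega> in M. mono_on {0..} (\<lambda>t. L t \<omega>))"

text \<open>Strict stationarity: all finite-dimensional distributions are shift invariant.\<close>

definition stationary_process :: "'a measure \<Rightarrow> (real \<Rightarrow> 'a \<Rightarrow> real) \<Rightarrow> bool" where
  "stationary_process M Y \<longleftrightarrow>
     process_on M Y \<and>
     (\<forall>J h. finite J \<and> J \<subseteq> {0..} \<and> 0 \<le> h \<longrightarrow>
        distr M (PiM J (\<lambda>_. borel)) (\<lambda>\<omega>. \<lambda>t\<in>J. Y (t + h) \<omega>)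
      = distr M (PiM J (\<lambda>_. borel)) (\<lambda>\<omega>. \<lambda>t\<in>J. Y t \<omega>))"

definition centered_stationary_noise :: "'a measure \<Rightarrow> (real \<Rightarrow> 'a \<Rightarrow> real) \<Rightarrow> bool" where
  "centered_stationary_noise M \<epsilon> \<longleftrightarrow>
     stationary_process M \<epsilon> \<and>
     (\<forall>t\<ge>0. \<forall>k::nat. integrable M (\<lambda>\<omega>. \<bar>\<epsilon> t \<omega>\<bar> ^ k)) \<and>
     (\<forall>t\<ge>0. prob_space.expectation M (\<epsilon> t) = 0)"

definition white_noise :: "'a measure \<Rightarrow> (real \<Rightarrow> 'a \<Rightarrow> real) \<Rightarrow> bool" where
  "white_noise M \<epsilon> \<longleftrightarrow>
     prob_space.indep_vars M (\<lambda>_. borel) \<epsilon> {0..} \<and>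
     (\<forall>s\<ge>0. \<forall>t\<ge>0. distr M borel (\<epsilon> s) = distr M borel (\<epsilon> t))"


section \<open>Grids, realized variations and the estimator\<close>

definition mesh :: "real \<Rightarrow> nat \<Rightarrow> real" where
  "mesh T n = T / real n"

definition grid_time :: "real \<Rightarrow> nat \<Rightarrow> nat \<Rightarrow> real" where
  "grid_time T n i = real i * mesh T n"

text \<open>A grid is the strictly increasing list of its points.\<close>

definition full_grid :: "real \<Rightarrow> nat \<Rightarrow> real list" where
  "full_grid T n = map (grid_time T n) [0..<Suc n]"

definition subgrid_steps :: "nat \<Rightarrow> nat \<Rightarrow> nat \<Rightarrow> nat" where
  "subgrid_steps n K i = (n - i + 1) div K"

definition subgrid :: "real \<Rightarrow> nat \<Rightarrow> nat \<Rightarrow> nat \<Rightarrow> real list" where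
  "subgrid T n K i = map (\<lambda>j. grid_time T n (i - 1 + j * K)) [0..<Suc (subgrid_steps n K i)]"

definition subgrid_length :: "real \<Rightarrow> nat \<Rightarrow> nat \<Rightarrow> nat \<Rightarrow> real" where
  "subgrid_length T n K i = real K * mesh T n * real (subgrid_steps n K i)"

definition power_variation :: "nat \<Rightarrow> real list \<Rightarrow> (real \<Rightarrow> real) \<Rightarrow> real" where
  "power_variation l g y = (\<Sum>j<length g - 1. \<bar>y (g ! Suc j) - y (g ! j)\<bar> ^ l)"

definition kappa_hat :: "real \<Rightarrow> real \<Rightarrow> nat \<Rightarrow> nat \<Rightarrow> (real \<Rightarrow> real) \<Rightarrow> real" where
  "kappa_hat \<sigma> T n K y =
     1 / (3 * \<sigma> ^ 4 * (real K - 1)) *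
       (\<Sum>i = 1..K. 1 / subgrid_length T n K i * power_variation 4 (subgrid T n K i) y)
     - 1 / (3 * \<sigma> ^ 4 * (real K - 1) * T) * power_variation 4 (full_grid T n) y
     - 2 / (real n * \<sigma>\<^sup>2) * power_variation 2 (full_grid T n) y
     - (real K - 1) * mesh T n"

text \<open>For \<open>K \<ge> 2\<close>, the condition \<open>2 * K - 1 \<le> n\<close> says that every subgrid has at least one step;
  see \<open>subgrid_steps_pos_iff\<close>.\<close>

definition admissible :: "real \<Rightarrow> nat \<Rightarrow> nat \<Rightarrow> bool" where
  "admissible T n K \<longleftrightarrow> 0 < T \<and> 2 \<le> K \<and> 2 * K - 1 \<le> n"

lemma subgrid_steps_pos_iff:
  assumes "2 \<le> K"
  shows "(\<forall>i\<in>{1..K}. 1 \<le> subgrid_steps n K i) \<longleftrightarrow> 2 * K - 1 \<le> n"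
proof
  assume "\<forall>i\<in>{1..K}. 1 \<le> subgrid_steps n K i"
  hence "1 \<le> (n - K + 1) div K" using assms by (auto simp: subgrid_steps_def)
  hence "K \<le> n - K + 1" by (metis div_less not_one_le_zero not_le)
  thus "2 * K - 1 \<le> n" using assms by linarith
next
  assume n: "2 * K - 1 \<le> n"
  show "\<forall>i\<in>{1..K}. 1 \<le> subgrid_steps n K i"
  proof
    fix i assume "i \<in> {1..K}"
    hence "K \<le> n - i + 1" using n assms by auto
    hence "K div K \<le> (n - i + 1) div K" by (rule div_le_mono)
    thus "1 \<le> subgrid_steps n K i" using assms by (simp add: subgrid_steps_def)
  qed
qed


section \<open>Bias\<close>

text \<open>Integrability is explicit because the Bochner integral of a non-integrable function is \<open>0\<close>.\<close>

definition has_expectation :: "'a measure \<Rightarrow> ('a \<Rightarrow> real) \<Rightarrow> real \<Rightarrow> bool" where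
  "has_expectation M Z v \<longleftrightarrow> integrable M Z \<and> prob_space.expectation M Z = v"

definition unbiased_estimator :: "'a measure \<Rightarrow> ('a \<Rightarrow> real) \<Rightarrow> real \<Rightarrow> bool" where
  "unbiased_estimator M Z \<theta> \<longleftrightarrow> has_expectation M Z \<theta>"

text \<open>The regime in which both the mesh \<open>T / n\<close> and the coarse mesh \<open>K * T / n\<close> tend to \<open>0\<close>, with
  \<open>(T, n, K)\<close> otherwise ranging freely over the admissible triples.\<close>

definition high_frequency :: "(real \<times> nat \<times> nat) filter" where
  "high_frequency =
     inf (filtercomap (\<lambda>(T, n, K). mesh T n) (nhds 0))
    (inf (filtercomap (\<lambda>(T, n, K). real K * mesh T n) (nhds 0))
         (principal {(T, n, K). admissible T n K}))"

text \<open>It contains the regime in which \<open>n\<close> tends to infinity with \<open>T\<close> and \<open>K\<close> fixed.\<close>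

lemma fixed_horizon_high_frequency:
  assumes "0 < T" "2 \<le> K"
  shows "filterlim (\<lambda>n. (T, n, K)) high_frequency sequentially"
proof -
  have 1: "(\<lambda>n. mesh T n) \<longlonglongrightarrow> 0"
    unfolding mesh_def by (rule lim_const_over_n)
  have 2: "(\<lambda>n. real K * mesh T n) \<longlonglongrightarrow> 0"
    using tendsto_mult_right_zero[OF 1] by simp
  have 3: "eventually (\<lambda>n. admissible T n K) sequentially"
    using eventually_ge_at_top[of "2 * K - 1"] by eventually_elim (use assms in \<open>simp add: admissible_def\<close>)
  show ?thesis
    unfolding high_frequency_def filterlim_inf filterlim_filtercomap_iff filterlim_principal
    using 1 2 3 by (simp add: o_def)
qed

definition asymptotically_unbiased ::
    "'a measure \<Rightarrow> (real \<Rightarrow> nat \<Rightarrow> nat \<Rightarrow> 'a \<Rightarrow> real) \<Rightarrow> real \<Rightarrow> bool" where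
  "asymptotically_unbiased M Z \<theta> \<longleftrightarrow>
     (\<forall>T n K. admissible T n K \<longrightarrow> integrable M (Z T n K)) \<and>
     ((\<lambda>(T, n, K). prob_space.expectation M (Z T n K) - \<theta>) \<longlongrightarrow> 0) high_frequency"

end

theory Submission
  imports Defs
begin

text \<open>By independence of \<open>\<tau>\<close> and \<open>W\<close>, an increment \<open>W (\<tau> t) - W (\<tau> s)\<close> has the law of
  \<open>sqrt (\<tau> t - \<tau> s) * Z\<close> with an independent standard normal \<open>Z\<close>; this is checked on
  characteristic functions.  Hence its odd moments vanish, and its second and fourth moments over a
  step \<open>h\<close> are \<open>h\<close> and \<open>3 (\<kappa> h + h\<^sup>2)\<close>.  Adding the independent noise, the observed increment has
  second moment \<open>\<sigma>\<^sup>2 h + e\<^sub>2 h\<close> and fourth moment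
  \<open>3 \<sigma>\<^sup>4 (\<kappa> h + h\<^sup>2) + 6 \<sigma>\<^sup>2 h e\<^sub>2 h + e\<^sub>4 h\<close>, where \<open>e\<^sub>l h\<close> is the \<open>l\<close>-th moment of the
  noise increment.  The bias formula is then a linear combination of these values at
  \<open>h = \<delta>\<close> and \<open>h = K \<delta>\<close>.  For white noise \<open>e\<^sub>l h\<close> does not depend on \<open>h\<close>; in general
  the bias is \<open>2 / \<sigma>\<^sup>2 * K \<delta>\<close> times the difference quotient of \<open>e\<^sub>2\<close> between \<open>\<delta>\<close> and \<open>K \<delta>\<close>,
  plus \<open>1 / (3 \<sigma>\<^sup>4)\<close> times that of \<open>e\<^sub>4\<close>.\<close>

section \<open>Brownian motion at independent random times\<close>

text \<open>Rounding the random times to this countable grid makes \<open>W\<close> evaluated at them measurable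
  without joint measurability of \<open>W\<close>; path continuity removes the rounding in the limit.\<close>

definition ceiling_grid :: "nat \<Rightarrow> real \<Rightarrow> real" where
  "ceiling_grid m x = real (nat \<lceil>x * real (Suc m)\<rceil>) / real (Suc m)"

text \<open>\<open>nat\<close> clips negative arguments to 0, so rounded times lie in the index set
  of \<open>W\<close> on every path, even on the null set where a random time is negative.\<close>

lemma ceiling_grid_nonneg: "0 \<le> ceiling_grid m x"
  by (simp add: ceiling_grid_def)

lemma ceiling_grid_tendsto:
  assumes "0 \<le> x"
  shows "(\<lambda>m. ceiling_grid m x) \<longlonglongrightarrow> x"
proof -
  have eq: "ceiling_grid m x = of_int \<lceil>x * real (Suc m)\<rceil> / real (Suc m)" for m
    using assms by (simp add: ceiling_grid_def)
  have "x \<le> ceiling_grid m x" for m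
    unfolding eq by (subst pos_le_divide_eq) (auto intro: le_of_int_ceiling)
  hence "eventually (\<lambda>m. x \<le> ceiling_grid m x) sequentially" by (rule always_eventually[OF allI])
  moreover have "ceiling_grid m x \<le> x + 1 / real (Suc m)" for m
  proof -
    have "of_int \<lceil>x * real (Suc m)\<rceil> \<le> x * real (Suc m) + 1"
      by (rule of_int_ceiling_le_add_one)
    thus ?thesis unfolding eq by (simp add: field_simps del: of_nat_Suc)
  qed
  hence "eventually (\<lambda>m. ceiling_grid m x \<le> x + 1 / real (Suc m)) sequentially"
    by (rule always_eventually[OF allI])
  moreover have "(\<lambda>m. x + 1 / real (Suc m)) \<longlonglongrightarrow> x"
    using tendsto_add[OF tendsto_const LIMSEQ_inverse_real_of_nat, of x]
    by (simp add: inverse_eq_divide)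
  ultimately show ?thesis
    by (rule tendsto_sandwich[OF _ _ tendsto_const])
qed

text \<open>The absolute value admits times in either order: the random times are ordered only
  almost surely, while this formula is applied to every frozen path of them.\<close>

lemma brownian_increment_char:
  fixes W :: "real \<Rightarrow> 'a \<Rightarrow> real"
  assumes "prob_space M" and W: "standard_brownian_motion M W" and "0 \<le> a" "0 \<le> b"
  shows "(CLINT \<omega>|M. iexp (u * (W b \<omega> - W a \<omega>))) = exp (- (u\<^sup>2 * \<bar>b - a\<bar> / 2))"
proof -
  interpret prob_space M by fact
  have less: "(CLINT \<omega>|M. iexp (u * (W t \<omega> - W s \<omega>))) = exp (- (u\<^sup>2 * (t - s) / 2))"
    if st: "0 \<le> s" "s < t" for s t u :: real
  proof -
    define r where "r = sqrt (t - s)"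
    have r: "0 < r" "r\<^sup>2 = t - s" using st by (auto simp: r_def)
    have "distributed M lborel (\<lambda>\<omega>. W t \<omega> - W s \<omega>) (normal_density 0 r)"
      using W st unfolding standard_brownian_motion_def r_def by blast
    hence d: "distributed M lborel (\<lambda>\<omega>. (W t \<omega> - W s \<omega>) / r) std_normal_density"
      by (subst (asm) normal_standard_normal_convert) (use r in auto)
    hence m: "(\<lambda>\<omega>. (W t \<omega> - W s \<omega>) / r) \<in> measurable M lborel"
      and D: "distr M lborel (\<lambda>\<omega>. (W t \<omega> - W s \<omega>) / r) = std_normal_distribution"
      by (auto simp: distributed_def)
    have "(CLINT \<omega>|M. iexp (u * (W t \<omega> - W s \<omega>)))
        = (CLINT \<omega>|M. iexp (u * r * ((W t \<omega> - W s \<omega>) / r)))"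
      using r by simp
    also have "\<dots> = char std_normal_distribution (u * r)"
      unfolding D[symmetric] char_def by (subst integral_distr[OF m]) auto
    also have "\<dots> = exp (- (u\<^sup>2 * (t - s) / 2))"
      using r by (simp add: char_std_normal_distribution power_mult_distrib)
    finally show ?thesis .
  qed
  consider "a < b" | "a = b" | "b < a" by linarith
  then show ?thesis
  proof cases
    case 1 thus ?thesis using less[of a b u] assms by simp
  next
    case 2 thus ?thesis by (simp add: prob_space)
  next
    case 3
    \<comment> \<open>Swapping the times changes the sign of \<open>u\<close>, which enters the
      result only through its square.\<close>
    have "(CLINT \<omega>|M. iexp (u * (W b \<omega> - W a \<omega>))) = (CLINT \<omega>|M. iexp (- u * (W a \<omega> - W b \<omega>)))"
      by (simp add: algebra_simps)
    also have "\<dots> = exp (- ((- u)\<^sup>2 * (a - b) / 2))"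
      using less[of b a "- u"] 3 assms by blast
    finally show ?thesis using 3 by simp
  qed
qed

text \<open>Independence makes the joint law of the two paths a product, so Fubini freezes the path
  of \<tau> and leaves a Brownian increment over deterministic times. This is done at rounded times;
  dominated convergence then removes the rounding. Measurability of the increment is assumed because
  continuity of almost all paths alone does not provide it.\<close>

lemma time_changed_brownian_increment_char:
  fixes W :: "real \<Rightarrow> 'a \<Rightarrow> real"
  assumes "prob_space M" and W: "standard_brownian_motion M W"
    and ind: "indep_processes M \<tau> W" and st: "0 \<le> s" "0 \<le> t"
    and ae: "AE \<omega> in M. 0 \<le> \<tau> s \<omega>" "AE \<omega> in M. \<tau> s \<omega> \<le> \<tau> t \<omega>"
    and meas: "(\<lambda>\<omega>. W (\<tau> t \<omega>) \<omega> - W (\<tau> s \<omega>) \<omega>) \<in> borel_measurable M"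
  shows "(CLINT \<omega>|M. iexp (u * (W (\<tau> t \<omega>) \<omega> - W (\<tau> s \<omega>) \<omega>)))
       = of_real (LINT \<omega>|M. exp (- (u\<^sup>2 * (\<tau> t \<omega> - \<tau> s \<omega>) / 2)))"
proof -
  interpret prob_space M by fact
  let ?P = "PiM {0..} (\<lambda>_::real. borel :: real measure)"
  let ?\<tau> = "\<lambda>\<omega>. \<lambda>r\<in>{0..}. \<tau> r \<omega>" and ?W = "\<lambda>\<omega>. \<lambda>t\<in>{0..}. W t \<omega>"
  let ?g = ceiling_grid
  have T[measurable]: "?\<tau> \<in> measurable M ?P"
    and Wm[measurable]: "?W \<in> measurable M ?P"
    and joint: "distr M ?P ?\<tau> \<Otimes>\<^sub>M distr M ?P ?W
          = distr M (?P \<Otimes>\<^sub>M ?P) (\<lambda>\<omega>. (?\<tau> \<omega>, ?W \<omega>))"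
    using ind unfolding indep_processes_def indep_var_distribution_eq by blast+
  have \<tau>_meas[measurable]: "\<tau> r \<in> borel_measurable M" if "0 \<le> r" for r
    using measurable_compose[OF T measurable_component_singleton[of r]] that by simp
  note [measurable] = \<tau>_meas[OF st(1)] \<tau>_meas[OF st(2)]
  have gm[measurable]: "?g m \<in> borel_measurable borel" for m
    unfolding ceiling_grid_def by measurable
  interpret P1: prob_space "distr M ?P ?\<tau>" by (rule prob_space_distr) fact
  interpret P2: prob_space "distr M ?P ?W" by (rule prob_space_distr) fact
  interpret PP: pair_prob_space "distr M ?P ?\<tau>" "distr M ?P ?W" ..
  have step: "(CLINT \<omega>|M. iexp (u * (W (?g m (\<tau> t \<omega>)) \<omega> - W (?g m (\<tau> s \<omega>)) \<omega>)))
       = (CLINT \<omega>|M. of_real (exp (- (u\<^sup>2 * \<bar>?g m (\<tau> t \<omega>) - ?g m (\<tau> s \<omega>)\<bar> / 2))))" for m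
  proof -
    define F where "F = (\<lambda>(p, w). iexp (u * (w (?g m (p t)) - w (?g m (p s)))))"
    \<comment> \<open>Coordinates of a path are measurable at fixed times; a random time with
      countably many values splits the space into countably many measurable pieces.\<close>
    have eval: "(\<lambda>q. snd q (?g m (h (fst q)))) \<in> borel_measurable (?P \<Otimes>\<^sub>M ?P)"
      if [measurable]: "h \<in> borel_measurable ?P" for h
      unfolding ceiling_grid_def
      by (rule measurable_compose_countable[where f = "\<lambda>k q. snd q (real k / real (Suc m))"
            and g = "\<lambda>q. nat \<lceil>h (fst q) * real (Suc m)\<rceil>"]) measurable
    have comp[measurable]: "(\<lambda>p. p s) \<in> borel_measurable ?P" "(\<lambda>p. p t) \<in> borel_measurable ?P"
      using st by (auto intro!: measurable_component_singleton)
    note [measurable] = eval[OF comp(1)] eval[OF comp(2)]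
    have F[measurable]: "F \<in> borel_measurable (?P \<Otimes>\<^sub>M ?P)"
    proof -
      have "(\<lambda>q. iexp (u * (snd q (?g m (fst q t)) - snd q (?g m (fst q s)))))
              \<in> borel_measurable (?P \<Otimes>\<^sub>M ?P)"
        by measurable
      thus ?thesis unfolding F_def by (simp add: case_prod_unfold)
    qed
    have intF: "integrable (distr M ?P ?\<tau> \<Otimes>\<^sub>M distr M ?P ?W) F"
    proof (rule PP.integrable_const_bound[where B = 1])
      have "cmod (F q) \<le> 1" for q
        by (simp only: F_def case_prod_unfold norm_exp_i_times order.refl)
      thus "AE q in distr M ?P ?\<tau> \<Otimes>\<^sub>M distr M ?P ?W. cmod (F q) \<le> 1" by simp
    qed measurable
    \<comment> \<open>\<open>F\<close> sees the paths restricted to nonnegative times, which changes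
      nothing because \<open>s\<close>, \<open>t\<close> and all rounded times are
      nonnegative.\<close>
    have "(CLINT \<omega>|M. iexp (u * (W (?g m (\<tau> t \<omega>)) \<omega> - W (?g m (\<tau> s \<omega>)) \<omega>)))
        = (CLINT \<omega>|M. F (?\<tau> \<omega>, ?W \<omega>))"
      using st by (simp add: F_def ceiling_grid_nonneg)
    also have "\<dots> = integral\<^sup>L (distr M ?P ?\<tau> \<Otimes>\<^sub>M distr M ?P ?W) F"
      unfolding joint by (rule integral_distr[symmetric]) measurable
    also have "\<dots> = (CLINT p|distr M ?P ?\<tau>. CLINT w|distr M ?P ?W. F (p, w))"
      by (rule PP.integral_fst'[OF intF, symmetric])
    also have "\<dots> = (CLINT p|distr M ?P ?\<tau>.
                      of_real (exp (- (u\<^sup>2 * \<bar>?g m (p t) - ?g m (p s)\<bar> / 2))))"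
    proof (rule Bochner_Integration.integral_cong[OF refl])
      \<comment> \<open>With \<open>p\<close> fixed, both times are deterministic, and the integral
        over the law of the \<open>W\<close>-path is the characteristic function of a Brownian
        increment.\<close>
      fix p :: "real \<Rightarrow> real" assume "p \<in> space (distr M ?P ?\<tau>)"
      hence [simp]: "p \<in> space ?P" by simp
      have "(\<lambda>w. F (p, w)) \<in> borel_measurable ?P" by measurable
      hence "(CLINT w|distr M ?P ?W. F (p, w)) = (CLINT \<omega>|M. F (p, ?W \<omega>))"
        by (intro integral_distr) auto
      also have "\<dots> = of_real (exp (- (u\<^sup>2 * \<bar>?g m (p t) - ?g m (p s)\<bar> / 2)))"
        using brownian_increment_char[OF \<open>prob_space M\<close> W ceiling_grid_nonneg ceiling_grid_nonneg]
        by (simp add: F_def ceiling_grid_nonneg)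
      finally show "(CLINT w|distr M ?P ?W. F (p, w)) = \<dots>" .
    qed
    also have "\<dots> = (CLINT \<omega>|M. of_real (exp (- (u\<^sup>2 * \<bar>?g m (\<tau> t \<omega>) - ?g m (\<tau> s \<omega>)\<bar> / 2))))"
      using st by (subst integral_distr) auto
    finally show ?thesis .
  qed
  have Wg[measurable]: "(\<lambda>\<omega>. W (?g m (C \<omega>)) \<omega>) \<in> borel_measurable M"
    if [measurable]: "C \<in> borel_measurable M" for C m
  proof -
    have "W (real k / real (Suc m)) \<in> borel_measurable M" for k
      using W by (simp add: standard_brownian_motion_def process_on_def)
    moreover have "(\<lambda>\<omega>. nat \<lceil>C \<omega> * real (Suc m)\<rceil>) \<in> measurable M (count_space UNIV)"
      by measurable
    ultimately show ?thesis unfolding ceiling_grid_def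
      by (rule measurable_compose_countable[where f = "\<lambda>k \<omega>. W (real k / real (Suc m)) \<omega>"])
  qed
  \<comment> \<open>Continuity of almost every path gives pointwise convergence, and the integrands
    have modulus 1.\<close>
  have lim1: "(\<lambda>m. CLINT \<omega>|M. iexp (u * (W (?g m (\<tau> t \<omega>)) \<omega> - W (?g m (\<tau> s \<omega>)) \<omega>)))
      \<longlonglongrightarrow> (CLINT \<omega>|M. iexp (u * (W (\<tau> t \<omega>) \<omega> - W (\<tau> s \<omega>) \<omega>)))"
  proof (rule integral_dominated_convergence[where w = "\<lambda>_. 1"])
    have "AE \<omega> in M. continuous_on {0..} (\<lambda>t. W t \<omega>)"
      using W by (simp add: standard_brownian_motion_def)
    with ae show "AE \<omega> in M. (\<lambda>m. iexp (u * (W (?g m (\<tau> t \<omega>)) \<omega> - W (?g m (\<tau> s \<omega>)) \<omega>)))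
        \<longlonglongrightarrow> iexp (u * (W (\<tau> t \<omega>) \<omega> - W (\<tau> s \<omega>) \<omega>))"
    proof eventually_elim
      case (elim \<omega>)
      have "(\<lambda>m. W (?g m x) \<omega>) \<longlonglongrightarrow> W x \<omega>" if "0 \<le> x" for x
        using that elim(3)
        by (intro continuous_on_tendsto_compose[OF elim(3) ceiling_grid_tendsto])
           (auto simp: ceiling_grid_nonneg)
      with elim have "(\<lambda>m. u * (W (?g m (\<tau> t \<omega>)) \<omega> - W (?g m (\<tau> s \<omega>)) \<omega>))
          \<longlonglongrightarrow> u * (W (\<tau> t \<omega>) \<omega> - W (\<tau> s \<omega>) \<omega>)"
        by (intro tendsto_mult tendsto_diff tendsto_const) auto
      thus ?case by (rule isCont_tendsto_compose[OF isCont_iexp])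
    qed
    show "AE \<omega> in M. cmod (iexp (u * (W (?g m (\<tau> t \<omega>)) \<omega> - W (?g m (\<tau> s \<omega>)) \<omega>))) \<le> 1" for m
      by (simp only: norm_exp_i_times order.refl eventually_True)
    note [measurable] = meas
    show "(\<lambda>\<omega>. iexp (u * (W (\<tau> t \<omega>) \<omega> - W (\<tau> s \<omega>) \<omega>))) \<in> borel_measurable M"
      by measurable
  qed auto
  have lim2: "(\<lambda>m. CLINT \<omega>|M. of_real (exp (- (u\<^sup>2 * \<bar>?g m (\<tau> t \<omega>) - ?g m (\<tau> s \<omega>)\<bar> / 2))))
      \<longlonglongrightarrow> (CLINT \<omega>|M. of_real (exp (- (u\<^sup>2 * \<bar>\<tau> t \<omega> - \<tau> s \<omega>\<bar> / 2))))"
  proof (rule integral_dominated_convergence[where w = "\<lambda>_. 1"])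
    show "AE \<omega> in M. (\<lambda>m. complex_of_real (exp (- (u\<^sup>2 * \<bar>?g m (\<tau> t \<omega>) - ?g m (\<tau> s \<omega>)\<bar> / 2))))
      \<longlonglongrightarrow> of_real (exp (- (u\<^sup>2 * \<bar>\<tau> t \<omega> - \<tau> s \<omega>\<bar> / 2)))"
      using ae by eventually_elim (intro tendsto_intros ceiling_grid_tendsto; simp)
  qed auto
  have "(CLINT \<omega>|M. iexp (u * (W (\<tau> t \<omega>) \<omega> - W (\<tau> s \<omega>) \<omega>)))
      = (CLINT \<omega>|M. of_real (exp (- (u\<^sup>2 * \<bar>\<tau> t \<omega> - \<tau> s \<omega>\<bar> / 2))))"
    using LIMSEQ_unique[OF lim1] lim2 unfolding step by blast
  also have "\<dots> = (CLINT \<omega>|M. of_real (exp (- (u\<^sup>2 * (\<tau> t \<omega> - \<tau> s \<omega>) / 2))))"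
  proof (rule integral_cong_AE)
    show "AE \<omega> in M. complex_of_real (exp (- (u\<^sup>2 * \<bar>\<tau> t \<omega> - \<tau> s \<omega>\<bar> / 2)))
        = of_real (exp (- (u\<^sup>2 * (\<tau> t \<omega> - \<tau> s \<omega>) / 2)))"
      using ae(2) by eventually_elim simp
  qed measurable
  finally show ?thesis by simp
qed

section \<open>Law and moments of a time-changed Brownian increment\<close>

lemma (in pair_sigma_finite) has_bochner_integral_product:
  fixes f g :: "_ \<Rightarrow> real"
  assumes f: "integrable M1 f" and g: "integrable M2 g"
  shows "has_bochner_integral (M1 \<Otimes>\<^sub>M M2) (\<lambda>p. f (fst p) * g (snd p))
           (integral\<^sup>L M1 f * integral\<^sup>L M2 g)"
proof -
  note [measurable] = borel_measurable_integrable[OF f] borel_measurable_integrable[OF g]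
  have int: "integrable (M1 \<Otimes>\<^sub>M M2) (\<lambda>p. f (fst p) * g (snd p))"
    by (rule Fubini_integrable) (use f g in \<open>auto simp: abs_mult\<close>)
  show ?thesis
    using integral_fst'[OF int] int by (simp add: has_bochner_integral_iff)
qed

text \<open>For fixed \<open>v \<ge> 0\<close> the variable \<open>sqrt v * Z\<close> has
  characteristic function \<open>exp (- (u\<^sup>2 * v / 2))\<close>. Averaging over the law of the
  time increment reproduces the formula just found, and characteristic functions determine laws.
  Moments can then be read off without differentiating characteristic functions.\<close>

lemma time_changed_brownian_increment_law:
  fixes W :: "real \<Rightarrow> 'a \<Rightarrow> real"
  assumes "prob_space M" and W: "standard_brownian_motion M W"
    and ind: "indep_processes M \<tau> W" and st: "0 \<le> s" "0 \<le> t"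
    and ae: "AE \<omega> in M. 0 \<le> \<tau> s \<omega>" "AE \<omega> in M. \<tau> s \<omega> \<le> \<tau> t \<omega>"
    and \<tau>[measurable]: "\<tau> s \<in> borel_measurable M" "\<tau> t \<in> borel_measurable M"
    and meas[measurable]: "(\<lambda>\<omega>. W (\<tau> t \<omega>) \<omega> - W (\<tau> s \<omega>) \<omega>) \<in> borel_measurable M"
  shows "distr M borel (\<lambda>\<omega>. W (\<tau> t \<omega>) \<omega> - W (\<tau> s \<omega>) \<omega>)
       = distr (distr M borel (\<lambda>\<omega>. \<tau> t \<omega> - \<tau> s \<omega>) \<Otimes>\<^sub>M std_normal_distribution) borel
               (\<lambda>p. sqrt (fst p) * snd p)"
proof (rule Levy_uniqueness)
  interpret prob_space M by fact
  let ?V = "distr M borel (\<lambda>\<omega>. \<tau> t \<omega> - \<tau> s \<omega>)"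
  let ?Y = "\<lambda>\<omega>. W (\<tau> t \<omega>) \<omega> - W (\<tau> s \<omega>) \<omega>"
  interpret V: prob_space ?V by (rule prob_space_distr) measurable
  interpret Z: real_distribution std_normal_distribution by (rule real_dist_normal_dist)
  interpret P: pair_prob_space ?V std_normal_distribution ..
  show "real_distribution (distr M borel ?Y)"
    unfolding real_distribution_def real_distribution_axioms_def
    using meas by (auto intro: prob_space_distr)
  have m[measurable]: "(\<lambda>p. sqrt (fst p) * snd p) \<in> borel_measurable (?V \<Otimes>\<^sub>M std_normal_distribution)"
    by measurable
  show "real_distribution (distr (?V \<Otimes>\<^sub>M std_normal_distribution) borel (\<lambda>p. sqrt (fst p) * snd p))"
    unfolding real_distribution_def real_distribution_axioms_def
    using m by (auto intro: P.prob_space_distr)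
  show "char (distr M borel ?Y)
      = char (distr (?V \<Otimes>\<^sub>M std_normal_distribution) borel (\<lambda>p. sqrt (fst p) * snd p))"
  proof
    fix u
    have int: "integrable (?V \<Otimes>\<^sub>M std_normal_distribution) (\<lambda>p. iexp (u * (sqrt (fst p) * snd p)))"
    proof (rule P.integrable_const_bound[where B = 1])
      show "AE p in ?V \<Otimes>\<^sub>M std_normal_distribution. cmod (iexp (u * (sqrt (fst p) * snd p))) \<le> 1"
        by (simp only: norm_exp_i_times order.refl eventually_True)
    qed measurable
    have "char (distr (?V \<Otimes>\<^sub>M std_normal_distribution) borel (\<lambda>p. sqrt (fst p) * snd p)) u
        = (CLINT p|?V \<Otimes>\<^sub>M std_normal_distribution. iexp (u * (sqrt (fst p) * snd p)))"
      unfolding char_def by (rule integral_distr[OF m]) measurable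
    also have "\<dots> = (CLINT v|?V. CLINT z|std_normal_distribution. iexp (u * (sqrt v * z)))"
      using P.integral_fst'[OF int] by simp
    also have "\<dots> = (CLINT v|?V. char std_normal_distribution (u * sqrt v))"
      by (simp only: char_def mult.assoc)
    also have "\<dots> = (CLINT v|?V. of_real (exp (- (u * sqrt v)\<^sup>2 / 2)))"
      by (simp only: char_std_normal_distribution)
    also have "\<dots> = (CLINT \<omega>|M. of_real (exp (- (u * sqrt (\<tau> t \<omega> - \<tau> s \<omega>))\<^sup>2 / 2)))"
      by (rule integral_distr) measurable
    also have "\<dots> = (CLINT \<omega>|M. of_real (exp (- (u\<^sup>2 * (\<tau> t \<omega> - \<tau> s \<omega>) / 2))))"
    proof (rule integral_cong_AE)
      \<comment> \<open>The square of \<open>sqrt x\<close> is \<open>x\<close> only for nonnegative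
        \<open>x\<close>, so this identity holds only almost surely.\<close>
      show "AE \<omega> in M. complex_of_real (exp (- (u * sqrt (\<tau> t \<omega> - \<tau> s \<omega>))\<^sup>2 / 2))
          = of_real (exp (- (u\<^sup>2 * (\<tau> t \<omega> - \<tau> s \<omega>) / 2)))"
        using ae(2) by eventually_elim (simp add: power_mult_distrib)
    qed measurable
    also have "\<dots> = (CLINT \<omega>|M. iexp (u * ?Y \<omega>))"
      using time_changed_brownian_increment_char[OF \<open>prob_space M\<close> W ind st ae meas, of u]
      by (simp only: integral_complex_of_real)
    also have "\<dots> = char (distr M borel ?Y) u"
      unfolding char_def by (rule integral_distr[symmetric]) measurable
    finally show "char (distr M borel ?Y) u
      = char (distr (?V \<Otimes>\<^sub>M std_normal_distribution) borel (\<lambda>p. sqrt (fst p) * snd p)) u" ..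
  qed
qed

text \<open>Under the product law \<open>(sqrt v * z) ^ k\<close> factors, and Fubini splits the
  moment. Powers of the square root treat odd and even \<open>k\<close> alike; for odd
  \<open>k\<close> the Gaussian factor vanishes.\<close>

lemma time_changed_brownian_increment_moment:
  fixes W :: "real \<Rightarrow> 'a \<Rightarrow> real"
  assumes "prob_space M" and W: "standard_brownian_motion M W"
    and ind: "indep_processes M \<tau> W" and st: "0 \<le> s" "0 \<le> t"
    and ae: "AE \<omega> in M. 0 \<le> \<tau> s \<omega>" "AE \<omega> in M. \<tau> s \<omega> \<le> \<tau> t \<omega>"
    and \<tau>[measurable]: "\<tau> s \<in> borel_measurable M" "\<tau> t \<in> borel_measurable M"
    and meas[measurable]: "(\<lambda>\<omega>. W (\<tau> t \<omega>) \<omega> - W (\<tau> s \<omega>) \<omega>) \<in> borel_measurable M"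
    and int: "integrable M (\<lambda>\<omega>. sqrt (\<tau> t \<omega> - \<tau> s \<omega>) ^ k)"
  shows "has_bochner_integral M (\<lambda>\<omega>. (W (\<tau> t \<omega>) \<omega> - W (\<tau> s \<omega>) \<omega>) ^ k)
    ((LINT \<omega>|M. sqrt (\<tau> t \<omega> - \<tau> s \<omega>) ^ k) * (LINT z|std_normal_distribution. z ^ k))"
proof -
  interpret prob_space M by fact
  let ?V = "distr M borel (\<lambda>\<omega>. \<tau> t \<omega> - \<tau> s \<omega>)"
  let ?Y = "\<lambda>\<omega>. W (\<tau> t \<omega>) \<omega> - W (\<tau> s \<omega>) \<omega>"
  let ?PZ = "?V \<Otimes>\<^sub>M std_normal_distribution"
  interpret V: prob_space ?V by (rule prob_space_distr) measurable
  interpret Z: real_distribution std_normal_distribution by (rule real_dist_normal_dist)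
  interpret P: pair_prob_space ?V std_normal_distribution ..
  have m[measurable]: "(\<lambda>p. sqrt (fst p) * snd p) \<in> borel_measurable ?PZ" by measurable
  have "has_bochner_integral ?PZ (\<lambda>p. sqrt (fst p) ^ k * snd p ^ k)
      ((LINT v|?V. sqrt v ^ k) * (LINT z|std_normal_distribution. z ^ k))"
    by (rule P.has_bochner_integral_product[OF _ integrable_std_normal_distribution_moment])
       (subst integrable_distr_eq, auto intro: int)
  also have "(LINT v|?V. sqrt v ^ k) = (LINT \<omega>|M. sqrt (\<tau> t \<omega> - \<tau> s \<omega>) ^ k)"
    by (rule integral_distr) measurable
  finally have *: "has_bochner_integral ?PZ (\<lambda>p. (sqrt (fst p) * snd p) ^ k)
      ((LINT \<omega>|M. sqrt (\<tau> t \<omega> - \<tau> s \<omega>) ^ k) * (LINT z|std_normal_distribution. z ^ k))"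
    by (simp only: power_mult_distrib)
  have law: "distr M borel ?Y = distr ?PZ borel (\<lambda>p. sqrt (fst p) * snd p)"
    by (rule time_changed_brownian_increment_law[OF \<open>prob_space M\<close> W ind st ae \<tau> meas])
  have pow: "(\<lambda>y::real. y ^ k) \<in> borel_measurable borel" by measurable
  show ?thesis
    using * integrable_distr_eq[OF meas pow] integral_distr[OF meas pow]
      integrable_distr_eq[OF m pow] integral_distr[OF m pow]
    unfolding law has_bochner_integral_iff by simp
qed

section \<open>Integrability of lower powers and moments of independent sums\<close>

lemma (in finite_measure) integrable_power_mono:
  fixes f :: "'a \<Rightarrow> real"
  assumes f[measurable]: "f \<in> borel_measurable M" and int: "integrable M (\<lambda>x. f x ^ n)"
    and "even n" "k \<le> n"
  shows "integrable M (\<lambda>x. f x ^ k)"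
proof (rule Bochner_Integration.integrable_bound)
  show "integrable M (\<lambda>x. 1 + f x ^ n)" using int by simp
  \<comment> \<open>The summand 1 covers \<open>\<bar>y\<bar> \<le> 1\<close>, the power
    \<open>n\<close> the rest; evenness of \<open>n\<close> identifies
    \<open>\<bar>y\<bar> ^ n\<close> with \<open>y ^ n\<close>.\<close>
  have "\<bar>y\<bar> ^ k \<le> 1 + \<bar>y\<bar> ^ n" for y :: real
    using power_le_one[of "\<bar>y\<bar>" k] power_increasing[of k n "\<bar>y\<bar>"] \<open>k \<le> n\<close>
    by (cases "\<bar>y\<bar> \<le> 1") (auto intro: add_increasing add_increasing2)
  thus "AE x in M. norm (f x ^ k) \<le> norm (1 + f x ^ n)"
    using \<open>even n\<close> by (simp add: power_abs power_even_abs zero_le_even_power)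
qed measurable

text \<open>In the binomial expansion every mixed term of odd degree in \<open>Y\<close> contains
  the first or third moment of \<open>Y\<close> and drops out. The roles are asymmetric on purpose:
  \<open>X\<close> will be the noise increment, whose third moment is unknown, and \<open>Y\<close>
  the symmetric signal increment.\<close>

lemma (in prob_space) indep_sum_moments:
  fixes X Y :: "'a \<Rightarrow> real"
  assumes ind: "indep_var borel X borel Y"
    and X4: "integrable M (\<lambda>x. X x ^ 4)" and Y4: "integrable M (\<lambda>x. Y x ^ 4)"
    and Y1: "expectation Y = 0" and Y3: "expectation (\<lambda>x. Y x ^ 3) = 0"
  shows "has_bochner_integral M (\<lambda>x. (X x + Y x) ^ 2)
           (expectation (\<lambda>x. X x ^ 2) + expectation (\<lambda>x. Y x ^ 2))"
    and "has_bochner_integral M (\<lambda>x. (X x + Y x) ^ 4)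
           (expectation (\<lambda>x. X x ^ 4)
            + 6 * (expectation (\<lambda>x. X x ^ 2) * expectation (\<lambda>x. Y x ^ 2))
            + expectation (\<lambda>x. Y x ^ 4))"
proof -
  have Xm: "X \<in> borel_measurable M" and Ym: "Y \<in> borel_measurable M"
    using indep_var_rv1[OF ind] indep_var_rv2[OF ind] .
  have Xk: "integrable M (\<lambda>x. X x ^ k)" and Yk: "integrable M (\<lambda>x. Y x ^ k)" if "k \<le> 4" for k
    using integrable_power_mono[OF Xm X4] integrable_power_mono[OF Ym Y4] that by auto
  have H: "has_bochner_integral M (\<lambda>x. X x ^ i * Y x ^ j)
      (expectation (\<lambda>x. X x ^ i) * expectation (\<lambda>x. Y x ^ j))" if ij: "i \<le> 4" "j \<le> 4" for i j
  proof -
    have "indep_var borel ((\<lambda>y. y ^ i) \<circ> X) borel ((\<lambda>y. y ^ j) \<circ> Y)"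
      by (rule indep_var_compose[OF ind]) measurable
    hence i: "indep_var borel (\<lambda>x. X x ^ i) borel (\<lambda>x. Y x ^ j)" by (simp add: comp_def)
    show ?thesis
      using indep_var_integrable[OF i Xk[OF ij(1)] Yk[OF ij(2)]]
        indep_var_lebesgue_integral[OF i Xk[OF ij(1)] Yk[OF ij(2)]]
      by (simp add: has_bochner_integral_iff)
  qed
  \<comment> \<open>The exponents 0 and 1 are kept explicit so that every term is an instance of
    \<open>H\<close>.\<close>
  have "has_bochner_integral M
      (\<lambda>x. X x ^ 2 * Y x ^ 0 + 2 * (X x ^ 1 * Y x ^ 1) + X x ^ 0 * Y x ^ 2)
      (expectation (\<lambda>x. X x ^ 2) * expectation (\<lambda>x. Y x ^ 0)
       + 2 * (expectation (\<lambda>x. X x ^ 1) * expectation (\<lambda>x. Y x ^ 1))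
       + expectation (\<lambda>x. X x ^ 0) * expectation (\<lambda>x. Y x ^ 2))"
    by (intro has_bochner_integral_add has_bochner_integral_mult_right H) auto
  thus "has_bochner_integral M (\<lambda>x. (X x + Y x) ^ 2)
           (expectation (\<lambda>x. X x ^ 2) + expectation (\<lambda>x. Y x ^ 2))"
    by (simp add: Y1 prob_space power2_sum add_ac mult_ac)
  have "has_bochner_integral M
      (\<lambda>x. X x ^ 4 * Y x ^ 0 + 4 * (X x ^ 3 * Y x ^ 1) + 6 * (X x ^ 2 * Y x ^ 2)
           + 4 * (X x ^ 1 * Y x ^ 3) + X x ^ 0 * Y x ^ 4)
      (expectation (\<lambda>x. X x ^ 4) * expectation (\<lambda>x. Y x ^ 0)
       + 4 * (expectation (\<lambda>x. X x ^ 3) * expectation (\<lambda>x. Y x ^ 1))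
       + 6 * (expectation (\<lambda>x. X x ^ 2) * expectation (\<lambda>x. Y x ^ 2))
       + 4 * (expectation (\<lambda>x. X x ^ 1) * expectation (\<lambda>x. Y x ^ 3))
       + expectation (\<lambda>x. X x ^ 0) * expectation (\<lambda>x. Y x ^ 4))"
    by (intro has_bochner_integral_add has_bochner_integral_mult_right H) auto
  moreover have "(X x + Y x) ^ 4 = X x ^ 4 * Y x ^ 0 + 4 * (X x ^ 3 * Y x ^ 1)
      + 6 * (X x ^ 2 * Y x ^ 2) + 4 * (X x ^ 1 * Y x ^ 3) + X x ^ 0 * Y x ^ 4" for x
    by (simp add: eval_nat_numeral algebra_simps)
  ultimately show "has_bochner_integral M (\<lambda>x. (X x + Y x) ^ 4)
           (expectation (\<lambda>x. X x ^ 4)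
            + 6 * (expectation (\<lambda>x. X x ^ 2) * expectation (\<lambda>x. Y x ^ 2))
            + expectation (\<lambda>x. Y x ^ 4))"
    by (simp only: Y1 Y3 power_one_right power_0 prob_space integral_const) (simp add: prob_space Y1 Y3)
qed

lemma has_expectation_iff: "has_expectation M Z v \<longleftrightarrow> has_bochner_integral M Z v"
  by (simp add: has_expectation_def has_bochner_integral_iff)

section \<open>Coordinates and increments of independent processes\<close>

lemma indep_processes_component_measurable:
  assumes "prob_space M" "indep_processes M Y Z" "0 \<le> t"
  shows "Y t \<in> borel_measurable M" "Z t \<in> borel_measurable M"
proof -
  interpret prob_space M by fact
  have ind: "indep_var (PiM {0..} (\<lambda>_. borel)) (\<lambda>\<omega>. \<lambda>t\<in>{0..}. Y t \<omega>)
                       (PiM {0..} (\<lambda>_. borel)) (\<lambda>\<omega>. \<lambda>t\<in>{0..}. Z t \<omega>)"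
    using assms(2) by (simp add: indep_processes_def)
  show "Y t \<in> borel_measurable M" "Z t \<in> borel_measurable M"
    using measurable_compose[OF indep_var_rv1[OF ind] measurable_component_singleton[of t]]
      measurable_compose[OF indep_var_rv2[OF ind] measurable_component_singleton[of t]] \<open>0 \<le> t\<close>
    by simp_all
qed

lemma indep_processes_increments:
  assumes "prob_space M" "indep_processes M Y Z" and st: "0 \<le> s" "0 \<le> t"
  shows "prob_space.indep_var M borel (\<lambda>\<omega>. Y t \<omega> - Y s \<omega>) borel (\<lambda>\<omega>. Z t \<omega> - Z s \<omega>)"
proof -
  interpret prob_space M by fact
  have ind: "indep_var (PiM {0..} (\<lambda>_. borel)) (\<lambda>\<omega>. \<lambda>t\<in>{0..}. Y t \<omega>)
                       (PiM {0..} (\<lambda>_. borel)) (\<lambda>\<omega>. \<lambda>t\<in>{0..}. Z t \<omega>)"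
    using assms(2) by (simp add: indep_processes_def)
  have "(\<lambda>p::real \<Rightarrow> real. p t - p s) \<in> borel_measurable (PiM {0..} (\<lambda>_. borel))"
    using st by (intro borel_measurable_diff measurable_component_singleton) auto
  from indep_var_compose[OF ind this this] show ?thesis
    using st by (simp add: comp_def)
qed

section \<open>Moments of the subordinator and of the subordinated Brownian motion\<close>

lemma subordinator_AE:
  assumes "subordinator M \<tau>" and "0 \<le> s" "s \<le> t"
  shows "AE \<omega> in M. 0 \<le> \<tau> s \<omega>" "AE \<omega> in M. \<tau> s \<omega> \<le> \<tau> t \<omega>"
proof -
  have 0: "AE \<omega> in M. \<tau> 0 \<omega> = 0" and m: "AE \<omega> in M. mono_on {0..} (\<lambda>t. \<tau> t \<omega>)"
    using assms(1) by (auto simp: subordinator_def levy_process_def)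
  show "AE \<omega> in M. 0 \<le> \<tau> s \<omega>"
    using 0 m
  proof eventually_elim
    case (elim \<omega>)
    thus ?case using mono_onD[OF elim(2), of 0 s] assms by simp
  qed
  show "AE \<omega> in M. \<tau> s \<omega> \<le> \<tau> t \<omega>"
    using m
  proof eventually_elim
    case (elim \<omega>)
    thus ?case using mono_onD[OF elim, of s t] assms by simp
  qed
qed

text \<open>Stationarity moves the increment to \<open>[0, h]\<close>, where it equals
  \<open>\<tau> h\<close> almost surely; its second moment is the variance plus the squared
  mean.\<close>

lemma subordinator_increment_moments:
  assumes "prob_space M" and sub: "subordinator M \<tau>" and "0 < \<kappa>" and "0 \<le> s" "0 < h"
    and mean: "prob_space.expectation M (\<tau> h) = h"
    and var: "prob_space.variance M (\<tau> h) = \<kappa> * h"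
  shows "has_bochner_integral M (\<lambda>\<omega>. \<tau> (s + h) \<omega> - \<tau> s \<omega>) h"
    and "has_bochner_integral M (\<lambda>\<omega>. (\<tau> (s + h) \<omega> - \<tau> s \<omega>) ^ 2) (\<kappa> * h + h ^ 2)"
proof -
  interpret prob_space M by fact
  have m: "\<tau> r \<in> borel_measurable M" if "0 \<le> r" for r
    using sub that by (simp add: subordinator_def levy_process_def process_on_def)
  have D[measurable]: "(\<lambda>\<omega>. \<tau> (s + h) \<omega> - \<tau> s \<omega>) \<in> borel_measurable M"
      "(\<lambda>\<omega>. \<tau> h \<omega> - \<tau> 0 \<omega>) \<in> borel_measurable M"
    and mh[measurable]: "\<tau> h \<in> borel_measurable M"
    using m[of s] m[of "s + h"] m[of h] m[of 0] assms by auto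
  have law: "distr M borel (\<lambda>\<omega>. \<tau> (s + h) \<omega> - \<tau> s \<omega>) = distr M borel (\<lambda>\<omega>. \<tau> h \<omega> - \<tau> 0 \<omega>)"
    using sub assms by (simp add: subordinator_def levy_process_def stationary_increments_def)
  have zero: "AE \<omega> in M. \<tau> h \<omega> - \<tau> 0 \<omega> = \<tau> h \<omega>"
    using sub by (auto simp: subordinator_def levy_process_def)
  have transfer: "has_bochner_integral M (\<lambda>\<omega>. (\<tau> (s + h) \<omega> - \<tau> s \<omega>) ^ k) v"
    if "has_bochner_integral M (\<lambda>\<omega>. \<tau> h \<omega> ^ k) v" for k v
  proof -
    have "has_bochner_integral M (\<lambda>\<omega>. (\<tau> h \<omega> - \<tau> 0 \<omega>) ^ k) v"
    proof (subst has_bochner_integral_cong_AE)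
      show "AE \<omega> in M. (\<tau> h \<omega> - \<tau> 0 \<omega>) ^ k = \<tau> h \<omega> ^ k"
        using zero by eventually_elim simp
    qed (use that in measurable)
    moreover have pow: "(\<lambda>y::real. y ^ k) \<in> borel_measurable borel" by measurable
    ultimately show ?thesis
      using integrable_distr_eq[OF D(1) pow] integral_distr[OF D(1) pow]
        integrable_distr_eq[OF D(2) pow] integral_distr[OF D(2) pow]
      unfolding law has_bochner_integral_iff by simp
  qed
  \<comment> \<open>A non-integrable function has Bochner integral 0, so the positive mean
    \<open>h\<close> forces integrability. The positive variance \<open>\<kappa> * h\<close> does
    the same for the centered square in \<open>i2\<close>.\<close>
  have i1: "integrable M (\<tau> h)"
    using not_integrable_integral_eq[of M "\<tau> h"] mean \<open>0 < h\<close> by fastforce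
  have "0 < \<kappa> * h" using assms by simp
  hence i2: "integrable M (\<lambda>\<omega>. (\<tau> h \<omega> - h) ^ 2)"
    using not_integrable_integral_eq[of M "\<lambda>\<omega>. (\<tau> h \<omega> - h) ^ 2"] var mean by fastforce
  show "has_bochner_integral M (\<lambda>\<omega>. \<tau> (s + h) \<omega> - \<tau> s \<omega>) h"
    using transfer[of 1 h] i1 mean by (simp add: has_bochner_integral_iff)
  have "has_bochner_integral M (\<lambda>\<omega>. (\<tau> h \<omega> - h) ^ 2 + 2 * h * \<tau> h \<omega> - h ^ 2)
      (\<kappa> * h + 2 * h * h - h ^ 2)"
    using i1 i2 var mean by (simp add: has_bochner_integral_iff prob_space)
  hence "has_bochner_integral M (\<lambda>\<omega>. \<tau> h \<omega> ^ 2) (\<kappa> * h + h ^ 2)"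
    by (simp add: power2_eq_square algebra_simps)
  thus "has_bochner_integral M (\<lambda>\<omega>. (\<tau> (s + h) \<omega> - \<tau> s \<omega>) ^ 2) (\<kappa> * h + h ^ 2)"
    by (rule transfer)
qed

text \<open>With \<open>V\<close> the subordinator increment, the moment of order \<open>k\<close>
  is the mean of \<open>sqrt V ^ k\<close> times a Gaussian moment. Square integrability of
  \<open>V\<close> covers all \<open>k \<le> 4\<close>, including the odd orders.\<close>

lemma subordinated_brownian_increment_moments:
  fixes W :: "real \<Rightarrow> 'a \<Rightarrow> real"
  assumes "prob_space M" and W: "standard_brownian_motion M W" and sub: "subordinator M \<tau>"
    and ind: "indep_processes M \<tau> W" and "0 < \<kappa>" and s: "0 \<le> s" and h: "0 < h"
    and mean: "prob_space.expectation M (\<tau> h) = h"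
    and var: "prob_space.variance M (\<tau> h) = \<kappa> * h"
    and meas: "(\<lambda>\<omega>. W (\<tau> (s + h) \<omega>) \<omega> - W (\<tau> s \<omega>) \<omega>) \<in> borel_measurable M"
  defines "Y \<equiv> \<lambda>\<omega>. W (\<tau> (s + h) \<omega>) \<omega> - W (\<tau> s \<omega>) \<omega>"
  shows "has_bochner_integral M (\<lambda>\<omega>. Y \<omega> ^ 2) h"
    and "has_bochner_integral M (\<lambda>\<omega>. Y \<omega> ^ 4) (3 * (\<kappa> * h + h ^ 2))"
    and "odd k \<Longrightarrow> k \<le> 4 \<Longrightarrow> has_bochner_integral M (\<lambda>\<omega>. Y \<omega> ^ k) 0"
proof -
  interpret prob_space M by fact
  let ?V = "\<lambda>\<omega>. \<tau> (s + h) \<omega> - \<tau> s \<omega>"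
  have nonneg: "AE \<omega> in M. 0 \<le> \<tau> s \<omega>" and le: "AE \<omega> in M. \<tau> s \<omega> \<le> \<tau> (s + h) \<omega>"
    using subordinator_AE[OF sub, of s "s + h"] s h by auto
  have tm: "\<tau> s \<in> borel_measurable M" "\<tau> (s + h) \<in> borel_measurable M"
    using sub s h by (auto simp: subordinator_def levy_process_def process_on_def)
  have sq: "AE \<omega> in M. sqrt (?V \<omega>) ^ 2 = ?V \<omega>" "AE \<omega> in M. sqrt (?V \<omega>) ^ 4 = ?V \<omega> ^ 2"
  proof -
    show 2: "AE \<omega> in M. sqrt (?V \<omega>) ^ 2 = ?V \<omega>"
      using le by eventually_elim simp
    have sqrt4: "sqrt x ^ 4 = x\<^sup>2" if "0 \<le> x" for x
      using power_mult[of "sqrt x" 2 2] that by simp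
    show "AE \<omega> in M. sqrt (?V \<omega>) ^ 4 = ?V \<omega> ^ 2"
      using le by eventually_elim (simp add: sqrt4)
  qed
  note V = subordinator_increment_moments[OF \<open>prob_space M\<close> sub \<open>0 < \<kappa>\<close> s h mean var]
  have V2: "has_bochner_integral M (\<lambda>\<omega>. sqrt (?V \<omega>) ^ 2) h"
    by (subst has_bochner_integral_cong_AE[OF _ _ sq(1)]) (use V tm in measurable)
  have V4: "has_bochner_integral M (\<lambda>\<omega>. sqrt (?V \<omega>) ^ 4) (\<kappa> * h + h ^ 2)"
    by (subst has_bochner_integral_cong_AE[OF _ _ sq(2)]) (use V tm in measurable)
  have moment: "has_bochner_integral M (\<lambda>\<omega>. Y \<omega> ^ k)
      ((LINT \<omega>|M. sqrt (?V \<omega>) ^ k) * (LINT z|std_normal_distribution. z ^ k))" if "k \<le> 4" for k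
    unfolding Y_def
  proof (rule time_changed_brownian_increment_moment[OF \<open>prob_space M\<close> W ind _ _ nonneg le tm meas])
    have "(\<lambda>\<omega>. sqrt (?V \<omega>)) \<in> borel_measurable M" using tm by measurable
    moreover have "integrable M (\<lambda>\<omega>. sqrt (?V \<omega>) ^ 4)" using V4 by (rule integrable.intros)
    ultimately show "integrable M (\<lambda>\<omega>. sqrt (?V \<omega>) ^ k)"
      using integrable_power_mono[of "\<lambda>\<omega>. sqrt (?V \<omega>)" 4 k] that by simp
  qed (use s h in auto)
  \<comment> \<open>The even Gaussian moments are (2m)! / (2^m m!), here for m = 1 and m =
    2.\<close>
  have Z: "(LINT z|std_normal_distribution. z ^ 2) = 1" "(LINT z|std_normal_distribution. z ^ 4) = 3"
    using std_normal_distribution_even_moments(1)[of 1] std_normal_distribution_even_moments(1)[of 2]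
    by (simp_all add: fact_numeral)
  show "has_bochner_integral M (\<lambda>\<omega>. Y \<omega> ^ 2) h"
    using moment[of 2] V2 Z by (simp add: has_bochner_integral_iff)
  show "has_bochner_integral M (\<lambda>\<omega>. Y \<omega> ^ 4) (3 * (\<kappa> * h + h ^ 2))"
    using moment[of 4] V4 Z by (simp add: has_bochner_integral_iff)
  show "odd k \<Longrightarrow> k \<le> 4 \<Longrightarrow> has_bochner_integral M (\<lambda>\<omega>. Y \<omega> ^ k) 0"
    using moment[of k] by (simp add: integral_std_normal_distribution_moment_odd)
qed

section \<open>Noise increments\<close>

text \<open>The elementary quadratic bound is used twice; the constant 8 is 2^2 from squaring the
  first bound, times 2 from the second.\<close>

lemma diff_power4_le: "(a - b) ^ 4 \<le> 8 * (a ^ 4 + b ^ 4)" for a b :: real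
proof -
  have "(a - b)\<^sup>2 \<le> 2 * (a\<^sup>2 + b\<^sup>2)"
    using sum_squares_bound[of a "-b"] by (simp add: power2_diff)
  hence "((a - b)\<^sup>2)\<^sup>2 \<le> (2 * (a\<^sup>2 + b\<^sup>2))\<^sup>2" by (intro power_mono) auto
  also have "\<dots> \<le> 8 * ((a\<^sup>2)\<^sup>2 + (b\<^sup>2)\<^sup>2)"
    using sum_squares_bound[of "a\<^sup>2" "b\<^sup>2"] by (simp add: power2_sum power_mult_distrib)
  finally show ?thesis by simp
qed

lemma noise_increment_integrable:
  assumes "centered_stationary_noise M \<epsilon>" and "0 \<le> s" "0 \<le> t"
  shows "integrable M (\<lambda>\<omega>. (\<epsilon> t \<omega> - \<epsilon> s \<omega>) ^ 4)"
proof (rule Bochner_Integration.integrable_bound)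
  have "integrable M (\<lambda>\<omega>. \<epsilon> r \<omega> ^ 4)" if "0 \<le> r" for r
  proof -
    have "\<forall>k. integrable M (\<lambda>\<omega>. \<bar>\<epsilon> r \<omega>\<bar> ^ k)"
      using assms(1) that by (simp add: centered_stationary_noise_def)
    from spec[OF this, of 4] show ?thesis by simp
  qed
  thus "integrable M (\<lambda>\<omega>. 8 * (\<epsilon> t \<omega> ^ 4 + \<epsilon> s \<omega> ^ 4))"
    using assms by simp
  have "\<epsilon> r \<in> borel_measurable M" if "0 \<le> r" for r
    using assms(1) that
    by (simp add: centered_stationary_noise_def stationary_process_def process_on_def)
  thus "(\<lambda>\<omega>. (\<epsilon> t \<omega> - \<epsilon> s \<omega>) ^ 4) \<in> borel_measurable M"
    using assms by (intro borel_measurable_power borel_measurable_diff) auto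
  show "AE \<omega> in M. norm ((\<epsilon> t \<omega> - \<epsilon> s \<omega>) ^ 4) \<le> norm (8 * (\<epsilon> t \<omega> ^ 4 + \<epsilon> s \<omega> ^ 4))"
    using diff_power4_le by (intro AE_I2) (simp add: abs_of_nonneg zero_le_even_power)
qed

text \<open>Independence and equal marginals turn the joint law of the two noise values into a fixed
  product. The right-hand side is free of \<open>h\<close>, so no moment of the increment depends on
  the step.\<close>

lemma white_noise_increment_law:
  assumes "prob_space M" and white: "white_noise M \<epsilon>" and "0 < h"
  shows "distr M borel (\<lambda>\<omega>. \<epsilon> h \<omega> - \<epsilon> 0 \<omega>)
       = distr (distr M borel (\<epsilon> 0) \<Otimes>\<^sub>M distr M borel (\<epsilon> 0)) borel (\<lambda>p. fst p - snd p)"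
proof -
  interpret prob_space M by fact
  have iv: "indep_vars (\<lambda>_. borel) \<epsilon> {0..}"
    and eq: "distr M borel (\<epsilon> h) = distr M borel (\<epsilon> 0)"
    using white \<open>0 < h\<close> by (auto simp: white_noise_def)
  have m[measurable]: "\<epsilon> 0 \<in> borel_measurable M" "\<epsilon> h \<in> borel_measurable M"
    using iv \<open>0 < h\<close> by (auto simp: indep_vars_def)
  \<comment> \<open>Pairwise independence is obtained as independence of one variable from a sum
    over a singleton; \<open>0 < h\<close> keeps the two indices distinct.\<close>
  have "indep_var borel (\<epsilon> h) borel (\<epsilon> 0)"
    using indep_vars_sum[of "{0}" h \<epsilon>] indep_vars_subset[OF iv, of "{h, 0}"] \<open>0 < h\<close> by simp
  hence "distr M borel (\<epsilon> h) \<Otimes>\<^sub>M distr M borel (\<epsilon> 0)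
      = distr M (borel \<Otimes>\<^sub>M borel) (\<lambda>\<omega>. (\<epsilon> h \<omega>, \<epsilon> 0 \<omega>))"
    by (simp add: indep_var_distribution_eq)
  hence "distr (distr M borel (\<epsilon> 0) \<Otimes>\<^sub>M distr M borel (\<epsilon> 0)) borel (\<lambda>p. fst p - snd p)
      = distr (distr M (borel \<Otimes>\<^sub>M borel) (\<lambda>\<omega>. (\<epsilon> h \<omega>, \<epsilon> 0 \<omega>))) borel (\<lambda>p. fst p - snd p)"
    by (simp add: eq)
  also have "\<dots> = distr M borel (\<lambda>\<omega>. \<epsilon> h \<omega> - \<epsilon> 0 \<omega>)"
    by (subst distr_distr) (auto simp: comp_def)
  finally show ?thesis ..
qed

section \<open>Bias of the estimator\<close>

text \<open>Offset \<open>a\<close> and stride \<open>c\<close> cover both kinds of grid: 0 and 1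
  give the full grid, \<open>i - 1\<close> and \<open>K\<close> the subgrid with index
  \<open>i\<close>.\<close>

lemma power_variation_has_expectation:
  assumes "0 < mesh T n" "0 < c"
    and incr: "\<And>s h. 0 \<le> s \<Longrightarrow> 0 < h \<Longrightarrow>
          has_bochner_integral M (\<lambda>\<omega>. \<bar>Y (s + h) \<omega> - Y s \<omega>\<bar> ^ l) (\<mu> h)"
  shows "has_bochner_integral M
          (\<lambda>\<omega>. power_variation l (map (\<lambda>j. grid_time T n (a + j * c)) [0..<Suc m]) (\<lambda>t. Y t \<omega>))
          (real m * \<mu> (real c * mesh T n))"
proof -
  let ?s = "\<lambda>j. grid_time T n (a + j * c)"
  let ?g = "map ?s [0..<Suc m]"
  have pv: "power_variation l ?g (\<lambda>t. Y t \<omega>) = (\<Sum>j<m. \<bar>Y (?s j + real c * mesh T n) \<omega> - Y (?s j) \<omega>\<bar> ^ l)" for \<omega>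
  proof -
    have "?g ! j = ?s j" if "j \<le> m" for j
      using that nth_map[of j "[0..<Suc m]" ?s] by (simp del: upt_Suc)
    moreover have "?s (Suc j) = ?s j + real c * mesh T n" for j
      by (simp add: grid_time_def algebra_simps)
    ultimately show ?thesis
      unfolding power_variation_def by (intro sum.cong) (auto simp del: upt_Suc)
  qed
  have "has_bochner_integral M (\<lambda>\<omega>. \<Sum>j<m. \<bar>Y (?s j + real c * mesh T n) \<omega> - Y (?s j) \<omega>\<bar> ^ l)
      (\<Sum>j<m. \<mu> (real c * mesh T n))"
    by (intro has_bochner_integral_sum incr) (use assms in \<open>auto simp: grid_time_def\<close>)
  thus ?thesis unfolding pv by simp
qed

text \<open>With k = \<open>K\<close> and D the mesh, the two fourth-power terms give \<kappa> + (k
  + 1) D plus noise terms. The quadratic term subtracts 2 D and turns the second-moment noise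
  contribution into a multiple of \<open>e2 (k * D) - e2 D\<close>; the deterministic correction
  removes the remaining (k - 1) D.\<close>

lemma kappa_hat_has_expectation:
  assumes "prob_space M" and adm: "admissible T n K" and "\<sigma> > 0"
    and incr2: "\<And>s h. 0 \<le> s \<Longrightarrow> 0 < h \<Longrightarrow>
          has_bochner_integral M (\<lambda>\<omega>. \<bar>Y (s + h) \<omega> - Y s \<omega>\<bar> ^ 2) (\<sigma>\<^sup>2 * h + e2 h)"
    and incr4: "\<And>s h. 0 \<le> s \<Longrightarrow> 0 < h \<Longrightarrow>
          has_bochner_integral M (\<lambda>\<omega>. \<bar>Y (s + h) \<omega> - Y s \<omega>\<bar> ^ 4)
            (3 * \<sigma> ^ 4 * (\<kappa> * h + h ^ 2) + 6 * \<sigma>\<^sup>2 * h * e2 h + e4 h)"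
  shows "has_bochner_integral M (\<lambda>\<omega>. kappa_hat \<sigma> T n K (\<lambda>t. Y t \<omega>))
     (\<kappa> + 2 / \<sigma>\<^sup>2 * (real K / (real K - 1)) * (e2 (real K * mesh T n) - e2 (mesh T n))
      + 1 / (3 * \<sigma> ^ 4) *
        ((e4 (real K * mesh T n) - e4 (mesh T n)) / (mesh T n * (real K - 1))))"
proof -
  define D where "D = mesh T n"
  define k where "k = real K"
  define m4 where "m4 h = 3 * \<sigma> ^ 4 * (\<kappa> * h + h ^ 2) + 6 * \<sigma>\<^sup>2 * h * e2 h + e4 h" for h
  have T: "0 < T" and K: "2 \<le> K" and n: "0 < n" "2 * K - 1 \<le> n"
    using adm by (auto simp: admissible_def)
  have D: "0 < D" and nD: "T = real n * D" using T n by (auto simp: D_def mesh_def)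
  have k: "2 \<le> k" using K by (simp add: k_def)
  have steps: "0 < subgrid_steps n K i" if "i \<in> {1..K}" for i
    using subgrid_steps_pos_iff[OF K, of n] n that by force
  have full: "has_bochner_integral M (\<lambda>\<omega>. power_variation l (full_grid T n) (\<lambda>t. Y t \<omega>)) (real n * \<mu> D)"
    if "\<And>s h. 0 \<le> s \<Longrightarrow> 0 < h \<Longrightarrow> has_bochner_integral M (\<lambda>\<omega>. \<bar>Y (s + h) \<omega> - Y s \<omega>\<bar> ^ l) (\<mu> h)"
    for l \<mu>
    using power_variation_has_expectation[of T n 1 M Y l \<mu> 0 n, OF _ _ that] D
    by (simp add: D_def full_grid_def del: upt_Suc)
  have sub: "has_bochner_integral M (\<lambda>\<omega>. power_variation 4 (subgrid T n K i) (\<lambda>t. Y t \<omega>))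
      (real (subgrid_steps n K i) * m4 (k * D))" for i
    using power_variation_has_expectation[of T n K M Y 4 m4 "i - 1" "subgrid_steps n K i",
        OF _ _ incr4[folded m4_def]] D K
    by (simp add: D_def k_def subgrid_def del: upt_Suc)
  let ?v = "1 / (3 * \<sigma> ^ 4 * (k - 1)) *
        (\<Sum>i = 1..K. 1 / subgrid_length T n K i * (real (subgrid_steps n K i) * m4 (k * D)))
     - 1 / (3 * \<sigma> ^ 4 * (k - 1) * T) * (real n * m4 D)
     - 2 / (real n * \<sigma>\<^sup>2) * (real n * (\<sigma>\<^sup>2 * D + e2 D))"
  \<comment> \<open>Adding the deterministic correction back leaves a linear combination of power
    variations only.\<close>
  have "has_bochner_integral M (\<lambda>\<omega>. kappa_hat \<sigma> T n K (\<lambda>t. Y t \<omega>) + (k - 1) * D) ?v"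
    unfolding kappa_hat_def k_def[symmetric] D_def[symmetric] diff_add_cancel
    by (intro has_bochner_integral_diff has_bochner_integral_mult_right has_bochner_integral_sum
          sub full incr2 incr4[folded m4_def]) auto
  \<comment> \<open>The number of steps cancels against the length of the subgrid. A subgrid without
    steps would contribute 0, as division by 0 yields 0; admissibility excludes this.\<close>
  also have "(\<Sum>i = 1..K. 1 / subgrid_length T n K i * (real (subgrid_steps n K i) * m4 (k * D)))
      = (\<Sum>i = 1..K. m4 (k * D) / (k * D))"
    using steps D k by (intro sum.cong refl) (simp add: subgrid_length_def D_def k_def less_imp_neq)
  also have "\<dots> = m4 (k * D) / D" using k by (simp add: k_def)
  also have "1 / (3 * \<sigma> ^ 4 * (k - 1)) * (m4 (k * D) / D)
     - 1 / (3 * \<sigma> ^ 4 * (k - 1) * T) * (real n * m4 D)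
     - 2 / (real n * \<sigma>\<^sup>2) * (real n * (\<sigma>\<^sup>2 * D + e2 D))
     = \<kappa> + 2 / \<sigma>\<^sup>2 * (k / (k - 1)) * (e2 (k * D) - e2 D)
      + 1 / (3 * \<sigma> ^ 4) * ((e4 (k * D) - e4 D) / (D * (k - 1))) + (k - 1) * D"
  proof -
    have nz: "\<sigma> \<noteq> 0" "k - 1 \<noteq> 0" "D \<noteq> 0" "real n \<noteq> 0" using assms k D n by auto
    \<comment> \<open>Substituting \<open>q + 1\<close> for \<open>k\<close> makes the denominator
      \<open>k - 1\<close> a single variable, so that clearing denominators leaves a polynomial
      identity.\<close>
    define q where "q = k - 1"
    have kq: "k = q + 1" and "q \<noteq> 0" using nz by (auto simp: q_def)
    thus ?thesis
      using nz unfolding nD m4_def kq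
      by (simp add: divide_simps) algebra
  qed
  finally have main: "has_bochner_integral M (\<lambda>\<omega>. kappa_hat \<sigma> T n K (\<lambda>t. Y t \<omega>) + (k - 1) * D)
     (\<kappa> + 2 / \<sigma>\<^sup>2 * (k / (k - 1)) * (e2 (k * D) - e2 D)
      + 1 / (3 * \<sigma> ^ 4) * ((e4 (k * D) - e4 D) / (D * (k - 1))) + (k - 1) * D)" .
  interpret prob_space M by fact
  have "has_bochner_integral M (\<lambda>\<omega>. (k - 1) * D) ((k - 1) * D)"
    by (simp add: has_bochner_integral_iff prob_space)
  from has_bochner_integral_diff[OF main this] show ?thesis
    by (simp add: k_def D_def)
qed

section \<open>Limits along the high-frequency filter\<close>

lemma eventually_admissible: "eventually (\<lambda>(T, n, K). admissible T n K) high_frequency"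
proof -
  have "high_frequency \<le> principal {(T, n, K). admissible T n K}"
    unfolding high_frequency_def by (intro le_infI2 order.refl)
  from filter_leD[OF this] show ?thesis by (simp add: eventually_principal)
qed

text \<open>The filter forces convergence to 0 and admissibility forces positivity. The one-sided
  form matches the difference-quotient condition on the noise.\<close>

lemma high_frequency_mesh_at_right:
  "filterlim (\<lambda>(T, n, K). mesh T n) (at_right 0) high_frequency" (is "filterlim ?d _ _")
  "filterlim (\<lambda>(T, n, K). real K * mesh T n) (at_right 0) high_frequency" (is "filterlim ?c _ _")
proof -
  have pos: "eventually (\<lambda>q. 0 < ?d q \<and> 0 < ?c q) high_frequency"
    using eventually_admissible by (rule eventually_mono) (auto simp: admissible_def mesh_def)
  have le: "high_frequency \<le> filtercomap ?d (nhds 0)" "high_frequency \<le> filtercomap ?c (nhds 0)"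
    unfolding high_frequency_def by (intro le_infI1 le_infI2 order.refl)+
  have lim: "(?d \<longlongrightarrow> 0) high_frequency" "(?c \<longlongrightarrow> 0) high_frequency"
    using filterlim_mono[OF filterlim_filtercomap order.refl le(1)]
      filterlim_mono[OF filterlim_filtercomap order.refl le(2)] .
  show "filterlim ?d (at_right 0) high_frequency"
    using lim(1) eventually_mono[OF pos, of "\<lambda>q. ?d q \<in> {0<..} \<and> ?d q \<noteq> 0"]
    by (simp add: filterlim_at)
  show "filterlim ?c (at_right 0) high_frequency"
    using lim(2) eventually_mono[OF pos, of "\<lambda>q. ?c q \<in> {0<..} \<and> ?c q \<noteq> 0"]
    by (simp add: filterlim_at)
qed

section \<open>Bias formula, white noise and asymptotic unbiasedness\<close>

theorem proposition4p2:
  fixes M :: "'a measure" and N :: "'b measure"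
    and W \<tau> X \<epsilon> Xtilde :: "real \<Rightarrow> 'a \<Rightarrow> real"
    and epstilde :: "real \<Rightarrow> 'b \<Rightarrow> real"
    and \<sigma> \<kappa> :: real
  assumes "prob_space M" and "\<sigma> > 0" and "\<kappa> > 0"
    and "standard_brownian_motion M W"
    and "subordinator M \<tau>"
    and "indep_processes M \<tau> W"
    and "\<And>t. t \<ge> 0 \<Longrightarrow> prob_space.expectation M (\<tau> t) = t"
    and "\<And>t. t \<ge> 0 \<Longrightarrow> prob_space.variance M (\<tau> t) = \<kappa> * t"
    and "\<And>j::nat. j \<in> {1..8} \<Longrightarrow> integrable M (\<lambda>\<omega>. \<tau> 1 \<omega> ^ j)"
    and "\<And>t \<omega>. X t \<omega> = \<sigma> * W (\<tau> t \<omega>) \<omega>"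
    and "\<And>t \<omega>. Xtilde t \<omega> = X t \<omega> + \<epsilon> t \<omega>"
    and "centered_stationary_noise M \<epsilon>"
    and "indep_processes M \<epsilon> X"
    and "prob_space N"
    and "\<And>\<delta>. \<delta> > 0 \<Longrightarrow> epstilde \<delta> \<in> borel_measurable N"
    and "\<And>\<delta> t. \<delta> > 0 \<Longrightarrow> t \<ge> 0 \<Longrightarrow>
           distr N borel (epstilde \<delta>) = distr M borel (\<lambda>\<omega>. \<epsilon> (t + \<delta>) \<omega> - \<epsilon> t \<omega>)"
  shows "(white_noise M \<epsilon> \<longrightarrow>
            (\<forall>T n K. admissible T n K \<longrightarrow>
               unbiased_estimator M (\<lambda>\<omega>. kappa_hat \<sigma> T n K (\<lambda>t. Xtilde t \<omega>)) \<kappa>))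
       \<and> (\<forall>T n K. admissible T n K \<longrightarrow>
            has_expectation M (\<lambda>\<omega>. kappa_hat \<sigma> T n K (\<lambda>t. Xtilde t \<omega>))
             (\<kappa> + 2 / \<sigma>\<^sup>2 * (real K / (real K - 1)) *
                  (prob_space.expectation N (\<lambda>x. (epstilde (real K * mesh T n) x)\<^sup>2)
                   - prob_space.expectation N (\<lambda>x. (epstilde (mesh T n) x)\<^sup>2))
                + 1 / (3 * \<sigma> ^ 4) *
                  ((prob_space.expectation N (\<lambda>x. epstilde (real K * mesh T n) x ^ 4)
                    - prob_space.expectation N (\<lambda>x. epstilde (mesh T n) x ^ 4))
                   / (mesh T n * (real K - 1)))))
       \<and> ((\<forall>l::nat.
             ((\<lambda>(\<delta>1, \<delta>2).
                 (prob_space.expectation N (\<lambda>x. epstilde \<delta>2 x ^ l)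
                  - prob_space.expectation N (\<lambda>x. epstilde \<delta>1 x ^ l)) / (\<delta>2 - \<delta>1))
              \<longlongrightarrow> 0) (at_right 0 \<times>\<^sub>F at_right 0))
          \<longrightarrow> asymptotically_unbiased M
                (\<lambda>T n K \<omega>. kappa_hat \<sigma> T n K (\<lambda>t. Xtilde t \<omega>)) \<kappa>)"
proof -
  note P = assms(1) and \<sigma> = assms(2) and \<kappa> = assms(3) and W = assms(4) and sub = assms(5)
    and ind\<tau>W = assms(6) and mean = assms(7) and var = assms(8) and X = assms(10)
    and Xtilde = assms(11) and noise = assms(12) and ind\<epsilon>X = assms(13)
    and epstilde = assms(15) and law = assms(16)
  interpret prob_space M by (rule P)
  define e where "e l h = prob_space.expectation N (\<lambda>x. epstilde h x ^ l)" for l h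
  have \<epsilon>_meas: "\<epsilon> t \<in> borel_measurable M" and X_meas: "X t \<in> borel_measurable M" if "0 \<le> t" for t
    using indep_processes_component_measurable[OF P ind\<epsilon>X that] .
  \<comment> \<open>Equality in law carries moments from the space \<open>N\<close> to noise
    increments on \<open>M\<close>, with any starting time \<open>s\<close>.\<close>
  have e_eq: "e l h = expectation (\<lambda>\<omega>. (\<epsilon> (s + h) \<omega> - \<epsilon> s \<omega>) ^ l)" if "0 \<le> s" "0 < h" for l s h
  proof -
    have "e l h = (LINT y|distr N borel (epstilde h). y ^ l)"
      unfolding e_def by (rule integral_distr[symmetric]) (use epstilde that in auto)
    also have "\<dots> = (LINT y|distr M borel (\<lambda>\<omega>. \<epsilon> (s + h) \<omega> - \<epsilon> s \<omega>). y ^ l)"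
      using law that by simp
    also have "\<dots> = expectation (\<lambda>\<omega>. (\<epsilon> (s + h) \<omega> - \<epsilon> s \<omega>) ^ l)"
      by (rule integral_distr) (use \<epsilon>_meas that in auto)
    finally show ?thesis .
  qed
  have incr: "has_bochner_integral M (\<lambda>\<omega>. \<bar>Xtilde (s + h) \<omega> - Xtilde s \<omega>\<bar> ^ 2) (\<sigma>\<^sup>2 * h + e 2 h)"
      "has_bochner_integral M (\<lambda>\<omega>. \<bar>Xtilde (s + h) \<omega> - Xtilde s \<omega>\<bar> ^ 4)
        (3 * \<sigma> ^ 4 * (\<kappa> * h + h ^ 2) + 6 * \<sigma>\<^sup>2 * h * e 2 h + e 4 h)"
    if s: "0 \<le> s" and h: "0 < h" for s h
  proof -
    let ?Y = "\<lambda>\<omega>. W (\<tau> (s + h) \<omega>) \<omega> - W (\<tau> s \<omega>) \<omega>"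
    let ?\<epsilon> = "\<lambda>\<omega>. \<epsilon> (s + h) \<omega> - \<epsilon> s \<omega>" and ?X = "\<lambda>\<omega>. X (s + h) \<omega> - X s \<omega>"
    have XY: "?X \<omega> = \<sigma> * ?Y \<omega>" for \<omega>
      by (simp add: X algebra_simps)
    have YX: "?Y \<omega> = ?X \<omega> / \<sigma>" for \<omega>
      using \<sigma> by (simp add: X diff_divide_distrib)
    \<comment> \<open>Measurability of the time-changed increment comes from that of
      \<open>X\<close>, which is part of its independence from the noise, after division by
      \<sigma>.\<close>
    have Ym: "?Y \<in> borel_measurable M"
      unfolding YX using X_meas[of s] X_meas[of "s + h"] s h by auto
    note Y = subordinated_brownian_increment_moments[OF P W sub ind\<tau>W \<kappa> s h mean var Ym]
    have Xmom: "has_bochner_integral M (\<lambda>\<omega>. ?X \<omega> ^ l) (\<sigma> ^ l * v)"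
      if "has_bochner_integral M (\<lambda>\<omega>. ?Y \<omega> ^ l) v" for l v
      unfolding XY power_mult_distrib by (rule has_bochner_integral_mult_right) (use that in simp)
    have X2: "has_bochner_integral M (\<lambda>\<omega>. ?X \<omega> ^ 2) (\<sigma>\<^sup>2 * h)"
      and X4: "has_bochner_integral M (\<lambda>\<omega>. ?X \<omega> ^ 4) (\<sigma> ^ 4 * (3 * (\<kappa> * h + h ^ 2)))"
      and X1: "has_bochner_integral M (\<lambda>\<omega>. ?X \<omega> ^ 1) (\<sigma> ^ 1 * 0)"
      and X3: "has_bochner_integral M (\<lambda>\<omega>. ?X \<omega> ^ 3) (\<sigma> ^ 3 * 0)"
      using h by (intro Xmom Y; simp)+
    have ind: "indep_var borel ?\<epsilon> borel ?X"
      by (rule indep_processes_increments[OF P ind\<epsilon>X]) (use s h in auto)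
    have \<epsilon>4: "integrable M (\<lambda>\<omega>. ?\<epsilon> \<omega> ^ 4)"
      by (rule noise_increment_integrable[OF noise]) (use s h in auto)
    have zero: "expectation ?X = 0" "expectation (\<lambda>\<omega>. ?X \<omega> ^ 3) = 0"
      using X1 X3 by (simp_all add: has_bochner_integral_iff)
    note sum = indep_sum_moments[OF ind \<epsilon>4 integrable.intros[OF X4] zero]
    have inc: "Xtilde (s + h) \<omega> - Xtilde s \<omega> = ?\<epsilon> \<omega> + ?X \<omega>" for \<omega>
      by (simp add: Xtilde)
    show "has_bochner_integral M (\<lambda>\<omega>. \<bar>Xtilde (s + h) \<omega> - Xtilde s \<omega>\<bar> ^ 2) (\<sigma>\<^sup>2 * h + e 2 h)"
      using sum(1) has_bochner_integral_integral_eq[OF X2]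
      unfolding inc e_eq[OF s h] by (simp add: add.commute)
    have "expectation (\<lambda>\<omega>. ?\<epsilon> \<omega> ^ 4) + 6 * (expectation (\<lambda>\<omega>. ?\<epsilon> \<omega> ^ 2) * expectation (\<lambda>\<omega>. ?X \<omega> ^ 2))
          + expectation (\<lambda>\<omega>. ?X \<omega> ^ 4)
        = 3 * \<sigma> ^ 4 * (\<kappa> * h + h ^ 2) + 6 * \<sigma>\<^sup>2 * h * e 2 h + e 4 h"
      unfolding has_bochner_integral_integral_eq[OF X2] has_bochner_integral_integral_eq[OF X4]
        e_eq[OF s h] by (simp add: algebra_simps)
    thus "has_bochner_integral M (\<lambda>\<omega>. \<bar>Xtilde (s + h) \<omega> - Xtilde s \<omega>\<bar> ^ 4)
        (3 * \<sigma> ^ 4 * (\<kappa> * h + h ^ 2) + 6 * \<sigma>\<^sup>2 * h * e 2 h + e 4 h)"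
      using sum(2) unfolding inc by simp
  qed
  define bias where "bias = (\<lambda>(T, n, K).
      2 / \<sigma>\<^sup>2 * (real K / (real K - 1)) * (e 2 (real K * mesh T n) - e 2 (mesh T n))
      + 1 / (3 * \<sigma> ^ 4) *
        ((e 4 (real K * mesh T n) - e 4 (mesh T n)) / (mesh T n * (real K - 1))))"
  have exact: "has_expectation M (\<lambda>\<omega>. kappa_hat \<sigma> T n K (\<lambda>t. Xtilde t \<omega>)) (\<kappa> + bias (T, n, K))"
    if "admissible T n K" for T n K
    using kappa_hat_has_expectation[OF P that \<sigma> incr]
    by (simp add: has_expectation_iff bias_def add.assoc)
  have mesh_pos: "0 < mesh T n" "0 < real K * mesh T n" "2 \<le> real K" if "admissible T n K" for T n K
    using that by (auto simp: admissible_def mesh_def)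
  have white: "bias (T, n, K) = 0" if "white_noise M \<epsilon>" "admissible T n K" for T n K
  proof -
    have "e l h = e l h'" if hh: "0 < h" "0 < h'" for l h h'
    proof -
      have e_law: "e l h = (LINT y|distr M borel (\<lambda>\<omega>. \<epsilon> h \<omega> - \<epsilon> 0 \<omega>). y ^ l)" if "0 < h" for h
        using e_eq[of 0 h l] \<epsilon>_meas[of 0] \<epsilon>_meas[of h] that by (subst integral_distr) auto
      show ?thesis
        unfolding e_law[OF hh(1)] e_law[OF hh(2)]
          white_noise_increment_law[OF P \<open>white_noise M \<epsilon>\<close> hh(1)]
          white_noise_increment_law[OF P \<open>white_noise M \<epsilon>\<close> hh(2)] ..
    qed
    from this[OF mesh_pos(2,1)[OF that(2)]] show ?thesis by (simp add: bias_def)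
  qed
  have asymp: "(bias \<longlongrightarrow> 0) high_frequency"
    if lim: "\<forall>l. ((\<lambda>(\<delta>1, \<delta>2). (e l \<delta>2 - e l \<delta>1) / (\<delta>2 - \<delta>1)) \<longlongrightarrow> 0) (at_right 0 \<times>\<^sub>F at_right 0)"
  proof -
    let ?d = "\<lambda>(T, n, K :: nat). mesh T n" and ?c = "\<lambda>(T, n, K). real K * mesh T n"
    have d: "filterlim ?d (at_right 0) high_frequency" and c: "filterlim ?c (at_right 0) high_frequency"
      using high_frequency_mesh_at_right .
    have c0: "(?c \<longlongrightarrow> 0) high_frequency" using c by (simp add: filterlim_at)
    \<comment> \<open>This is the difference quotient between fine and coarse mesh; composing the
      condition on the noise with the pair of meshes sends it to 0.\<close>
    define r where "r l = (\<lambda>q. (e l (?c q) - e l (?d q)) / (?c q - ?d q))" for l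
    have r: "(r l \<longlongrightarrow> 0) high_frequency" for l
      using filterlim_compose[OF spec[OF lim, of l] filterlim_Pair[OF d c]]
      by (simp add: r_def case_prod_beta)
    have "((\<lambda>q. 2 / \<sigma>\<^sup>2 * ?c q * r 2 q + 1 / (3 * \<sigma> ^ 4) * r 4 q)
        \<longlongrightarrow> 2 / \<sigma>\<^sup>2 * 0 * 0 + 1 / (3 * \<sigma> ^ 4) * 0) high_frequency"
      by (intro tendsto_intros c0 r)
    moreover have "eventually (\<lambda>q. 2 / \<sigma>\<^sup>2 * ?c q * r 2 q + 1 / (3 * \<sigma> ^ 4) * r 4 q = bias q) high_frequency"
      using eventually_admissible
    proof eventually_elim
      case (elim q)
      obtain T n K where q: "q = (T, n, K)" by (cases q)
      define D where "D = mesh T n"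
      define k where "k = real K"
      \<comment> \<open>Since \<open>K \<ge> 2\<close>, the two meshes differ by the nonzero amount
        \<open>D * (k - 1)\<close>, so \<open>r\<close> is a genuine quotient here.\<close>
      have "D \<noteq> 0" "k - 1 \<noteq> 0"
        using mesh_pos[of T n K] elim by (auto simp: q D_def k_def)
      moreover have "k * D - D = D * (k - 1)" by (simp add: algebra_simps)
      ultimately show ?case
        by (simp add: q bias_def r_def D_def[symmetric] k_def[symmetric])
    qed
    ultimately show ?thesis by (simp add: filterlim_cong[OF refl refl])
  qed
  have asymptotic: "asymptotically_unbiased M (\<lambda>T n K \<omega>. kappa_hat \<sigma> T n K (\<lambda>t. Xtilde t \<omega>)) \<kappa>"
    if "(bias \<longlongrightarrow> 0) high_frequency"
  proof -
    \<comment> \<open>The bias formula is known on admissible triples only, which suffices because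
      they are eventual along the filter.\<close>
    have "((\<lambda>(T, n, K). expectation (\<lambda>\<omega>. kappa_hat \<sigma> T n K (\<lambda>t. Xtilde t \<omega>)) - \<kappa>) \<longlongrightarrow> 0) high_frequency"
      by (rule Lim_transform_eventually[OF that eventually_mono[OF eventually_admissible]])
         (use exact in \<open>auto simp: has_expectation_def\<close>)
    thus ?thesis using exact by (auto simp: asymptotically_unbiased_def has_expectation_def)
  qed
  show ?thesis
    using exact white asymptotic[OF asymp] unfolding unbiased_estimator_def bias_def e_def
    by (auto simp: add.assoc)
qed

end
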